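(* Let $(X,S)$ be the Jordan scheme $J_{32}$, i.e. the Jordan scheme of order $32$ constructed (as in the context) from an elementary abelian $2$-group $G$ of order $8$ and a $\{1,-1\}$-matrix $M=(M_{x,y})_{x,y\in G}$ satisfying $M_{x,xz}M_{x,yz}M_{y,xz}M_{y,yz}=-1$ for all $x,y,z\in G$ with $x\neq y$. Then its real adjacency Jordan algebra $\mathbb{R}S$ satisfies \[ \mathbb{R}S\cong 16\,\mathbb{R}\oplus(\mathbb{R}\oplus_f\mathbb{R}^8)\] as Jordan algebras, where $16\,\mathbb{R}$ denotes the direct sum of $16$ copies of $\mathbb{R}$ and $f(\boldsymbol{x},\boldsymbol{y})=\sum_{i=1}^8x_iy_i$ for $\boldsymbol{x}=(x_1,\dots,x_8),\boldsymbol{y}=(y_1,\dots,y_8)\in\mathbb{R}^8$.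
   Context: Jordan product: for square matrices $A,B$ of the same order, $A*B:=\frac{1}{2}(AB+BA)$. Jordan scheme: let $X$ be a finite set and let $S=\{A_0=I,A_1,\dots,A_d\}\subset M_X(\mathbb{C})$ be a set of symmetric $\{0,1\}$-matrices. $(X,S)$ is a Jordan scheme if (1) $\sum_{i=0}^d A_i=J$, the all-one matrix, and (2) there exist $p_{ij}^k\in\frac12\mathbb{Z}$ such that $A_i*A_j=\sum_{k=0}^d p_{ij}^kA_k$ for all $i,j$. Its real adjacency Jordan algebra is $\mathbb{R}S:=\bigoplus_{i=0}^d\mathbb{R}A_i$ with the product $*$. A (real) Jordan algebra is an $\mathbb{R}$-vector space with a bilinear product $*$ satisfying $a*b=b*a$ and $a^{*2}*(b*a)=(a^{*2}*b)*a$, where $a^{*2}=a*a$. Direct sums of Jordan algebras carry the componentwise product. $\mathbb{R}\oplus_fV$: for a real vector space $V$ with positive definite symmetric bilinear form $f$, this is the vector space $\mathbb{R}\oplus V$ (with basis element $1$ of $\mathbb{R}$) with product $(\alpha1+\boldsymbol{x})*(\beta1+\boldsymbol{y})=(\alpha\beta+f(\boldsymbol{x},\boldsymbol{y}))1+(\beta\boldsymbol{x}+\alpha\boldsymbol{y})$. Construction of the Jordan scheme from $(G,M)$: let $I_2$ and $J_2$ be the identity and all-one matrices of order $2$, $K_2=J_2-I_2$, $C_2=\langle h\rangle$ the group of order $2$, $H=C_2\times G$, and $E_{(s,t),(u,v)}$ the matrix units of $M_H(\mathbb{C})$. For $(s,t)\in H$ and $x,y\in G$ put \[ L_{x,y}=L^{(s,t)}_{x,y}:=\begin{cases}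 I_2 & \text{if } s=1,\ t=1,\\ J_2 & \text{if } s=1,\ t\neq 1,\\ I_2 & \text{if } s\neq 1 \text{ and } M_{x,y}=1,\\ K_2 & \text{if } s\neq 1\text{ and } M_{x,y}=-1,\end{cases}\] \[\sigma_{(s,t)}:=\sum_{g\in G}E_{(1,g),(s,gt)}\otimes L_{g,gt}+\sum_{g\in G}E_{(h,g),(hs,gt)}\otimes L_{gt,g},\] and let $\sigma'_{(s,t)}$ be the same expression with $L_{g,gt}$ and $L_{gt,g}$ replaced by $L_{g,gt}K_2$ and $L_{gt,g}K_2$ respectively. Then \[ S:=\{\sigma_{(1,1)},\sigma_{(1,1)}'\}\cup\{\sigma_{(1,t)} : t\in G,\ t\neq 1\}\cup\{\sigma_{(h,t)},\sigma_{(h,t)}' : t\in G\},\] a Jordan scheme on $4|G|$ points. For $|G|=8$ all admissible $M$ give combinatorially isomorphic Jordan schemes (i.e. equal up to relabeling the points), and $J_{32}$ denotes this scheme. An admissible $M$ for $G=\langle a,b,c\rangle$, with indices in the order $1,a,b,ab,c,ac,bc,abc$, is \[\begin{pmatrix} 1&1&1&1&1&1&1&1\\ 1&-1&1&-1&1&-1&-1&1\\ 1&-1&-1&1&1&1&-1&-1\\ 1&1&-1&-1&1&-1&1&-1\\ 1&-1&-1&-1&-1&1&1&1\\ 1&1&-1&1&-1&-1&-1&1\\ 1&1&1&-1&-1&1&-1&-1\\ 1&-1&1&1&-1&-1&1&-1 \end{pmatrix}.\] *)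

theory Defs
  imports "HOL-Analysis.Analysis"
begin

text \<open>
  Finite index sets are finite types: \<open>M\<^sub>X(\<complex>)\<close> is \<open>(complex, 'x) sqmat\<close>, with \<open>X = UNIV :: 'x set\<close>.
  Finite abelian groups are types of class \<open>{finite, ab_group_add}\<close>, so they are written additively:
  the product \<open>gt\<close> becomes \<open>g + t\<close> and the neutral element \<open>1\<close> becomes \<open>0\<close>. The group \<open>C\<^sub>2\<close> is the
  numeral type \<open>2\<close> of integers modulo 2, with generator \<open>h = 1\<close>, and \<open>C\<^sub>2 \<times> G\<close> is \<open>2 \<times> 'g\<close>.
\<close>

type_synonym ('a, 'x) sqmat = "(('a, 'x) vec, 'x) vec"

subsection \<open>Real Jordan algebras\<close>

text \<open>
  An algebra is carried by a subspace of a type of class \<open>real_vector\<close>, which provides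
  the vector space operations.
\<close>

record 'a alg =
  acarrier :: "'a set"
  amult :: "'a \<Rightarrow> 'a \<Rightarrow> 'a"

definition jordan_algebra :: "'a::real_vector alg \<Rightarrow> bool" where
  "jordan_algebra A \<longleftrightarrow>
     (let V = acarrier A; m = amult A in
       subspace V \<and>
       (\<forall>a\<in>V. \<forall>b\<in>V. m a b \<in> V) \<and>
       (\<forall>a\<in>V. \<forall>b\<in>V. \<forall>c\<in>V. m (a + b) c = m a c + m b c \<and> m a (b + c) = m a b + m a c) \<and>
       (\<forall>r. \<forall>a\<in>V. \<forall>b\<in>V. m (r *\<^sub>R a) b = r *\<^sub>R m a b \<and> m a (r *\<^sub>R b) = r *\<^sub>R m a b) \<and>
       (\<forall>a\<in>V. \<forall>b\<in>V. m a b = m b a) \<and>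
       (\<forall>a\<in>V. \<forall>b\<in>V. m (m a a) (m b a) = m (m (m a a) b) a))"

definition jordan_isomorphic :: "'a::real_vector alg \<Rightarrow> 'b::real_vector alg \<Rightarrow> bool"
    (infix "\<cong>\<^sub>J" 50) where
  "A \<cong>\<^sub>J B \<longleftrightarrow> jordan_algebra A \<and> jordan_algebra B \<and>
     (\<exists>\<phi>. bij_betw \<phi> (acarrier A) (acarrier B) \<and>
        (\<forall>a\<in>acarrier A. \<forall>b\<in>acarrier A. \<phi> (a + b) = \<phi> a + \<phi> b) \<and>
        (\<forall>r. \<forall>a\<in>acarrier A. \<phi> (r *\<^sub>R a) = r *\<^sub>R \<phi> a) \<and>
        (\<forall>a\<in>acarrier A. \<forall>b\<in>acarrier A. \<phi> (amult A a b) = amult B (\<phi> a) (\<phi> b)))"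

definition real_alg :: "real alg" where
  "real_alg = \<lparr>acarrier = UNIV, amult = (*)\<rparr>"

definition direct_sum :: "'a alg \<Rightarrow> 'b alg \<Rightarrow> ('a \<times> 'b) alg" (infixr "\<oplus>\<^sub>J" 65) where
  "A \<oplus>\<^sub>J B = \<lparr>acarrier = acarrier A \<times> acarrier B,
     amult = (\<lambda>(a, b) (a', b'). (amult A a a', amult B b b'))\<rparr>"

text \<open>The direct sum of \<open>CARD('n)\<close> copies of an algebra.\<close>

definition copies :: "'a alg \<Rightarrow> ('a ^ 'n) alg" where
  "copies A = \<lparr>acarrier = {v. \<forall>i. v $ i \<in> acarrier A},
     amult = (\<lambda>v w. \<chi> i. amult A (v $ i) (w $ i))\<rparr>"

text \<open>\<open>\<real> \<oplus>\<^sub>f V\<close>; it is only meant for a positive definite symmetric bilinear form \<open>f\<close>.\<close>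

definition spin_alg :: "('v::real_vector \<Rightarrow> 'v \<Rightarrow> real) \<Rightarrow> (real \<times> 'v) alg" where
  "spin_alg f = \<lparr>acarrier = UNIV,
     amult = (\<lambda>(\<alpha>, x) (\<beta>, y). (\<alpha> * \<beta> + f x y, \<beta> *\<^sub>R x + \<alpha> *\<^sub>R y))\<rparr>"

subsection \<open>Jordan schemes\<close>

definition jordan_prod :: "(complex, 'x::finite) sqmat \<Rightarrow> (complex, 'x::finite) sqmat \<Rightarrow> (complex, 'x::finite) sqmat" where
  "jordan_prod A B = (1/2) *\<^sub>R (A ** B + B ** A)"

definition all_one :: "(complex, 'x::finite) sqmat" where
  "all_one = (\<chi> i j. 1)"

definition jordan_scheme :: "(complex, 'x::finite) sqmat set \<Rightarrow> bool" where
  "jordan_scheme S \<longleftrightarrow>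
     finite S \<and> mat 1 \<in> S \<and>
     (\<forall>A\<in>S. transpose A = A \<and> (\<forall>i j. A $ i $ j \<in> {0, 1})) \<and>
     (\<Sum>A\<in>S. A) = all_one \<and>
     (\<forall>A\<in>S. \<forall>B\<in>S. \<exists>p :: (complex, 'x) sqmat \<Rightarrow> real.
        (\<forall>C\<in>S. 2 * p C \<in> \<int>) \<and> jordan_prod A B = (\<Sum>C\<in>S. p C *\<^sub>R C))"

definition adjacency_alg :: "(complex, 'x::finite) sqmat set \<Rightarrow> (complex, 'x::finite) sqmat alg" where
  "adjacency_alg S = \<lparr>acarrier = span S, amult = jordan_prod\<rparr>"

subsection \<open>The Jordan scheme of \<open>(G, M)\<close>\<close>

definition matrix_unit :: "'i::finite \<Rightarrow> 'i \<Rightarrow> (complex, 'i::finite) sqmat" where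
  "matrix_unit a b = (\<chi> i j. if i = a \<and> j = b then 1 else 0)"

definition kronecker ::
    "(complex, 'i::finite) sqmat \<Rightarrow> (complex, 'k::finite) sqmat \<Rightarrow> (complex, 'i \<times> 'k) sqmat"
    (infixl "\<otimes>\<^sub>K" 70) where
  "A \<otimes>\<^sub>K B = (\<chi> p q. A $ fst p $ fst q * B $ snd p $ snd q)"

definition I2 :: "(complex, 2) sqmat" where "I2 = mat 1"
definition J2 :: "(complex, 2) sqmat" where "J2 = all_one"
definition K2 :: "(complex, 2) sqmat" where "K2 = J2 - I2"

definition admissible :: "(int, 'g::{finite, ab_group_add}) sqmat \<Rightarrow> bool" where
  "admissible M \<longleftrightarrow>
     (\<forall>x y. M $ x $ y \<in> {1, -1}) \<and>
     (\<forall>x y z. x \<noteq> y \<longrightarrow>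
        M $ x $ (x + z) * M $ x $ (y + z) * M $ y $ (x + z) * M $ y $ (y + z) = -1)"

text \<open>The last case is \<open>M $ x $ y = -1\<close> when \<open>M\<close> is a \<open>{1, -1}\<close>-matrix.\<close>

definition Lmat :: "(int, 'g::{finite, ab_group_add}) sqmat \<Rightarrow> 2 \<times> 'g \<Rightarrow> 'g \<Rightarrow> 'g \<Rightarrow> (complex, 2) sqmat" where
  "Lmat M = (\<lambda>(s, t) x y.
     if s = 0 \<and> t = 0 then I2
     else if s = 0 then J2
     else if M $ x $ y = 1 then I2
     else K2)"

definition sigma ::
    "(int, 'g::{finite, ab_group_add}) sqmat \<Rightarrow> 2 \<times> 'g \<Rightarrow>
      (complex, (2 \<times> 'g) \<times> 2) sqmat" where
  "sigma M = (\<lambda>(s, t).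
     (\<Sum>g\<in>UNIV. matrix_unit (0, g) (s, g + t) \<otimes>\<^sub>K Lmat M (s, t) g (g + t)) +
     (\<Sum>g\<in>UNIV. matrix_unit (1, g) (1 + s, g + t) \<otimes>\<^sub>K Lmat M (s, t) (g + t) g))"

definition sigma' ::
    "(int, 'g::{finite, ab_group_add}) sqmat \<Rightarrow> 2 \<times> 'g \<Rightarrow>
      (complex, (2 \<times> 'g) \<times> 2) sqmat" where
  "sigma' M = (\<lambda>(s, t).
     (\<Sum>g\<in>UNIV. matrix_unit (0, g) (s, g + t) \<otimes>\<^sub>K (Lmat M (s, t) g (g + t) ** K2)) +
     (\<Sum>g\<in>UNIV. matrix_unit (1, g) (1 + s, g + t) \<otimes>\<^sub>K (Lmat M (s, t) (g + t) g ** K2)))"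

definition scheme ::
    "(int, 'g::{finite, ab_group_add}) sqmat \<Rightarrow>
      (complex, (2 \<times> 'g) \<times> 2) sqmat set" where
  "scheme M =
     {sigma M (0, 0), sigma' M (0, 0)} \<union>
     {sigma M (0, t) | t. t \<noteq> 0} \<union>
     {sigma M (1, t) | t. True} \<union> {sigma' M (1, t) | t. True}"

end

theory Submission
  imports Defs
begin

text \<open>
  Let \<open>H = C\<^sub>2 \<times> G\<close>, an elementary abelian 2-group, written additively, and let \<open>D\<^sub>2 = I\<^sub>2 - K\<^sub>2\<close>. Since
  \<open>L + L K\<^sub>2 = J\<^sub>2\<close> and \<open>L - L K\<^sub>2 = \<plusminus>D\<^sub>2\<close> for \<open>L \<in> {I\<^sub>2, K\<^sub>2}\<close>, the sums and differences of the matrices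
  \<open>\<sigma>\<^sub>h\<close> and \<open>\<sigma>'\<^sub>h\<close>, together with the remaining \<open>\<sigma>\<^sub>h\<close>, whose blocks are \<open>J\<^sub>2\<close>, split
  the real span of the scheme into two parts:

  \<^item> the matrices \<open>P\<^sub>h \<otimes> J\<^sub>2\<close>, where \<open>P\<^sub>h\<close> is the translation by \<open>h \<in> H\<close>;
  \<^item> the matrices \<open>I \<otimes> D\<^sub>2\<close> and \<open>N\<^sub>t \<otimes> D\<^sub>2\<close> for \<open>t \<in> G\<close>, where \<open>N\<^sub>t\<close> is the translation by \<open>(1, t)\<close>
    whose nonzero entries are replaced by the signs that \<open>M\<close> prescribes.

  The two parts annihilate each other because \<open>J\<^sub>2 D\<^sub>2 = D\<^sub>2 J\<^sub>2 = 0\<close>. As \<open>J\<^sub>2\<^sup>2 = 2 J\<^sub>2\<close>, the first part is the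
  group algebra of \<open>H\<close>, and the real characters of \<open>H\<close> give \<open>|H|\<close> orthogonal idempotents that span it.
  In the second part, the condition on \<open>M\<close> says exactly that \<open>N\<^sub>t N\<^sub>u + N\<^sub>u N\<^sub>t = 2 \<delta>\<^sub>t\<^sub>u I\<close>
  (\<open>clifford_relations\<close>), and \<open>D\<^sub>2\<^sup>2 = 2 D\<^sub>2\<close>; so after division by 2 one has a unit and \<open>|G|\<close> elements that
  satisfy the Clifford relations, that is, \<open>\<real> \<oplus>\<^sub>f \<real>\<^bsup>|G|\<^esup>\<close>. Together these elements have the multiplication
  table of \<open>|H| \<real> \<oplus> (\<real> \<oplus>\<^sub>f \<real>\<^bsup>|G|\<^esup>)\<close>, and such a table already determines the algebra
  (\<open>span_iso_copies_spin\<close>).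

  In particular the span is closed under the Jordan product, and this is the only axiom of a Jordan scheme
  that is not read off from the entries: the coefficients in a product of two members are then entries of
  that product, hence half-integers (\<open>jordan_schemeI\<close>).
\<close>

section \<open>Jordan algebras given by a multiplication table\<close>

text \<open>By commutativity, linearity has to be checked in the first argument only.\<close>

lemma jordan_algebraI:
  fixes A :: "'a::real_vector alg"
  assumes "subspace (acarrier A)"
    and closed: "\<And>a b. a \<in> acarrier A \<Longrightarrow> b \<in> acarrier A \<Longrightarrow> amult A a b \<in> acarrier A"
    and add: "\<And>a b c. a \<in> acarrier A \<Longrightarrow> b \<in> acarrier A \<Longrightarrow> c \<in> acarrier A \<Longrightarrow>
      amult A (a + b) c = amult A a c + amult A b c"
    and scale: "\<And>r a b. a \<in> acarrier A \<Longrightarrow> b \<in> acarrier A \<Longrightarrow>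
      amult A (r *\<^sub>R a) b = r *\<^sub>R amult A a b"
    and comm: "\<And>a b. a \<in> acarrier A \<Longrightarrow> b \<in> acarrier A \<Longrightarrow> amult A a b = amult A b a"
    and jordan: "\<And>a b. a \<in> acarrier A \<Longrightarrow> b \<in> acarrier A \<Longrightarrow>
      amult A (amult A a a) (amult A b a) = amult A (amult A (amult A a a) b) a"
  shows "jordan_algebra A"
proof -
  have "amult A a (b + c) = amult A a b + amult A a c"
    if "a \<in> acarrier A" "b \<in> acarrier A" "c \<in> acarrier A" for a b c
    using that add[of b c a] comm[of a b] comm[of a c] comm[of a "b + c"] subspace_add[OF assms(1)]
    by simp
  moreover have "amult A a (r *\<^sub>R b) = r *\<^sub>R amult A a b"
    if "a \<in> acarrier A" "b \<in> acarrier A" for r a b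
    using that scale[of b a r] comm[of a b] comm[of a "r *\<^sub>R b"] subspace_scale[OF assms(1)]
    by simp
  ultimately show ?thesis
    unfolding jordan_algebra_def Let_def using assms by simp
qed

lemma jordan_algebraD:
  assumes "jordan_algebra A"
  shows "subspace (acarrier A)"
    and "a \<in> acarrier A \<Longrightarrow> b \<in> acarrier A \<Longrightarrow> amult A a b \<in> acarrier A"
    and "a \<in> acarrier A \<Longrightarrow> b \<in> acarrier A \<Longrightarrow> c \<in> acarrier A \<Longrightarrow>
      amult A (a + b) c = amult A a c + amult A b c"
    and "a \<in> acarrier A \<Longrightarrow> b \<in> acarrier A \<Longrightarrow> amult A (r *\<^sub>R a) b = r *\<^sub>R amult A a b"
    and "a \<in> acarrier A \<Longrightarrow> b \<in> acarrier A \<Longrightarrow> amult A a b = amult A b a"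
    and "a \<in> acarrier A \<Longrightarrow> b \<in> acarrier A \<Longrightarrow>
      amult A (amult A a a) (amult A b a) = amult A (amult A (amult A a a) b) a"
  using assms unfolding jordan_algebra_def Let_def by blast+

lemma jordan_algebra_copies_real: "jordan_algebra (copies real_alg :: (real ^ 'n::finite) alg)"
  by (simp add: jordan_algebra_def copies_def real_alg_def vec_eq_iff subspace_UNIV algebra_simps)

text \<open>
  The Jordan identity holds because \<open>a * a = (\<alpha>\<^sup>2 + f(x, x)) 1 + 2 \<alpha> x\<close> is a linear combination of \<open>1\<close>
  and \<open>a\<close>, and multiplication by \<open>1\<close> and by \<open>a\<close> commute.
\<close>

lemma jordan_algebra_spin:
  fixes f :: "'v::real_vector \<Rightarrow> 'v \<Rightarrow> real"
  assumes bil: "bilinear f" and sym: "\<And>x y. f x y = f y x"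
  shows "jordan_algebra (spin_alg f)"
proof -
  note f_simps = bilinear_ladd[OF bil] bilinear_radd[OF bil] bilinear_lmul[OF bil] bilinear_rmul[OF bil]
  define m where "m = amult (spin_alg f)"
  have m: "m (\<alpha>, x) (\<beta>, y) = (\<alpha> * \<beta> + f x y, \<beta> *\<^sub>R x + \<alpha> *\<^sub>R y)" for \<alpha> \<beta> x y
    by (simp add: m_def spin_alg_def)
  have add: "m (a + b) c = m a c + m b c" for a b c
    by (cases a; cases b; cases c) (simp add: m f_simps algebra_simps)
  have scale: "m (r *\<^sub>R a) b = r *\<^sub>R m a b" for r a b
    by (cases a; cases b) (simp add: m f_simps algebra_simps)
  have comm: "m a b = m b a" for a b
    by (cases a; cases b) (simp add: m sym add.commute mult.commute)
  have jordan: "m (m a a) (m b a) = m (m (m a a) b) a" for a b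
  proof (cases a; cases b)
    fix \<alpha> x \<beta> y assume ab: "a = (\<alpha>, x)" "b = (\<beta>, y)"
    have "m a a = (\<alpha> * \<alpha> + f x x, (2 * \<alpha>) *\<^sub>R x)"
      by (simp add: ab m scaleR_add_left[symmetric])
    then show ?thesis
      by (simp add: ab m f_simps sym[of y x] algebra_simps)
  qed
  have carrier: "acarrier (spin_alg f) = UNIV" by (simp add: spin_alg_def)
  show ?thesis
    by (rule jordan_algebraI, unfold m_def[symmetric] carrier)
      (rule subspace_UNIV UNIV_I add scale comm jordan)+
qed

lemma jordan_algebra_direct_sum:
  assumes A: "jordan_algebra A" and B: "jordan_algebra B"
  shows "jordan_algebra (A \<oplus>\<^sub>J B)"
proof -
  have sum: "acarrier (A \<oplus>\<^sub>J B) = acarrier A \<times> acarrier B"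
    "amult (A \<oplus>\<^sub>J B) p q = (amult A (fst p) (fst q), amult B (snd p) (snd q))" for p q
    by (simp_all add: direct_sum_def case_prod_beta)
  show ?thesis
    by (rule jordan_algebraI)
      (auto simp: sum subspace_Times jordan_algebraD(1,2,3,4,6)[OF A] jordan_algebraD(1,2,3,4,6)[OF B]
        intro: jordan_algebraD(5)[OF A] jordan_algebraD(5)[OF B])
qed

text \<open>
  Transport of structure: since the Jordan axioms are identities, an injective linear map that turns the
  product of a Jordan algebra into \<open>m\<close> makes its image a Jordan algebra.
\<close>

lemma jordan_isomorphic_image:
  fixes B :: "'b::real_vector alg" and \<psi> :: "'b \<Rightarrow> 'a::real_vector"
  assumes B: "jordan_algebra B" and lin: "linear \<psi>"
    and inj: "inj_on \<psi> (acarrier B)"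
    and mult: "\<And>x y. x \<in> acarrier B \<Longrightarrow> y \<in> acarrier B \<Longrightarrow> m (\<psi> x) (\<psi> y) = \<psi> (amult B x y)"
  shows "\<lparr>acarrier = \<psi> ` acarrier B, amult = m\<rparr> \<cong>\<^sub>J B"
proof -
  have sub: "subspace (acarrier B)"
    and closed: "\<And>x y. x \<in> acarrier B \<Longrightarrow> y \<in> acarrier B \<Longrightarrow> amult B x y \<in> acarrier B"
    using B by (auto simp: jordan_algebra_def Let_def)
  note subs = subspace_add[OF sub] subspace_scale[OF sub]
  note lins = linear_add[OF lin, symmetric] linear_scale[OF lin, symmetric]
  have J: "jordan_algebra \<lparr>acarrier = \<psi> ` acarrier B, amult = m\<rparr>"
    by (rule jordan_algebraI)
      (auto simp: linear_subspace_image[OF lin sub] mult lins subs closed jordan_algebraD(3,4,6)[OF B]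
        intro!: arg_cong[OF jordan_algebraD(5)[OF B], of _ _ \<psi>])
  let ?\<phi> = "the_inv_into (acarrier B) \<psi>"
  have inv: "?\<phi> (\<psi> x) = x" if "x \<in> acarrier B" for x
    using the_inv_into_f_f[OF inj that] .
  have "bij_betw ?\<phi> (\<psi> ` acarrier B) (acarrier B)"
    by (simp add: bij_betw_the_inv_into inj inj_on_imp_bij_betw)
  then show ?thesis
    unfolding jordan_isomorphic_def using J B
    by (intro conjI exI[of _ ?\<phi>]) (simp_all add: lins mult subs closed inv)
qed

text \<open>
  The elements \<open>e i\<close>, \<open>u\<close>, \<open>f j\<close> multiply like the standard basis of \<open>n\<real> \<oplus> (\<real> \<oplus>\<^sub>f \<real>\<^sup>m)\<close>, so the map \<open>\<psi>\<close>
  that sends this basis to them is multiplicative. Their linear independence follows from the table: multiplication by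
  \<open>e i\<close> isolates the coefficient of \<open>e i\<close>, and multiplication by \<open>f k\<close> and then by some \<open>f l\<close> with
  \<open>l \<noteq> k\<close> isolates that of \<open>f k\<close>. For \<open>m = 1\<close> it can fail, since \<open>f\<close> may then be \<open>\<plusminus>u\<close>.
\<close>

lemma span_iso_copies_spin:
  fixes m :: "'a::real_vector \<Rightarrow> 'a \<Rightarrow> 'a"
    and e :: "'n::finite \<Rightarrow> 'a" and u :: 'a and f :: "'m::finite \<Rightarrow> 'a"
  assumes bil: "bilinear m" and comm: "\<And>x y. m x y = m y x"
    and ee: "\<And>i j. m (e i) (e j) = (if i = j then e i else 0)"
    and eu: "\<And>i. m (e i) u = 0" and ef: "\<And>i j. m (e i) (f j) = 0"
    and uu: "m u u = u" and uf: "\<And>j. m u (f j) = f j"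
    and ff: "\<And>i j. m (f i) (f j) = (if i = j then u else 0)"
    and e0: "\<And>i. e i \<noteq> 0" and u0: "u \<noteq> 0" and two: "2 \<le> CARD('m)"
  shows "\<lparr>acarrier = span (range e \<union> {u} \<union> range f), amult = m\<rparr> \<cong>\<^sub>J
    (copies real_alg :: (real ^ 'n) alg) \<oplus>\<^sub>J spin_alg (\<lambda>x y :: real ^ 'm. \<Sum>i\<in>UNIV. x $ i * y $ i)"
    (is "_ \<cong>\<^sub>J ?B")
proof -
  let ?f = "\<lambda>x y :: real ^ 'm. \<Sum>i\<in>UNIV. x $ i * y $ i"
  let ?E = "\<lambda>v :: real ^ 'n. \<Sum>i\<in>UNIV. v $ i *\<^sub>R e i"
  let ?F = "\<lambda>w :: real ^ 'm. \<Sum>j\<in>UNIV. w $ j *\<^sub>R f j"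
  define \<psi> where "\<psi> = (\<lambda>(v, r, w). ?E v + r *\<^sub>R u + ?F w)"
  note m_simps = bilinear_ladd[OF bil] bilinear_radd[OF bil] bilinear_lmul[OF bil] bilinear_rmul[OF bil]
    bilinear_lzero[OF bil] bilinear_rzero[OF bil]
  have msum: "m x (\<Sum>i\<in>A. c i) = (\<Sum>i\<in>A. m x (c i))" for x and A :: "'k set" and c
    using bil by (auto simp: bilinear_def linear_sum)
  have msum': "m (\<Sum>i\<in>A. c i) x = (\<Sum>i\<in>A. m (c i) x)" for x and A :: "'k set" and c
    unfolding comm[of _ x] by (rule msum)
  have ue: "m u (e i) = 0" and fe: "m (f j) (e i) = 0" and fu: "m (f j) u = f j" for i j
    using eu ef uf comm by metis+
  have jordan: "jordan_algebra ?B"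
  proof (intro jordan_algebra_direct_sum jordan_algebra_copies_real jordan_algebra_spin)
    show "bilinear ?f"
      by (auto simp: bilinear_def algebra_simps sum.distrib sum_distrib_left intro!: linearI)
  qed (simp add: mult.commute)
  have lin: "linear \<psi>"
    by (rule linearI) (auto simp: \<psi>_def algebra_simps sum.distrib scaleR_sum_right)
  have e\<psi>: "m (e i) (\<psi> (v, r, w)) = v $ i *\<^sub>R e i" for i v r w
    by (simp add: \<psi>_def m_simps msum ee eu ef if_distrib cong: if_cong)
  have f\<psi>: "m (f k) (\<psi> (v, r, w)) = r *\<^sub>R f k + w $ k *\<^sub>R u" for k v r w
    by (simp add: \<psi>_def m_simps msum fe fu ff if_distrib cong: if_cong)
  have u\<psi>: "m u (\<psi> (v, r, w)) = r *\<^sub>R u + ?F w" for v r w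
    by (simp add: \<psi>_def m_simps msum ue uu uf)
  have mult: "m (\<psi> x) (\<psi> y) = \<psi> (amult ?B x y)" for x y
  proof -
    obtain v r w v' r' w' where xy: "x = (v, r, w)" "y = (v', r', w')" by (metis surj_pair)
    have "m (\<psi> x) (\<psi> y) = (\<Sum>i\<in>UNIV. v $ i *\<^sub>R m (e i) (\<psi> y)) + r *\<^sub>R m u (\<psi> y)
        + (\<Sum>j\<in>UNIV. w $ j *\<^sub>R m (f j) (\<psi> y))"
      by (simp add: xy(1) \<psi>_def m_simps msum')
    also have "\<dots> = ?E (\<chi> i. v $ i * v' $ i) + (r * r' + ?f w w') *\<^sub>R u + ?F (r' *\<^sub>R w + r *\<^sub>R w')"
      by (simp add: xy(2) e\<psi> u\<psi> f\<psi> algebra_simps sum.distrib scaleR_sum_right scaleR_sum_left)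
    also have "\<dots> = \<psi> (amult ?B x y)"
      by (simp add: xy \<psi>_def direct_sum_def copies_def real_alg_def spin_alg_def)
    finally show ?thesis .
  qed
  have "inj \<psi>"
  proof (subst linear_injective_0[OF lin], intro allI impI)
    fix x assume x0: "\<psi> x = 0"
    obtain v r w where x: "x = (v, r, w)" by (metis surj_pair)
    have "v $ i = 0" for i
      using e\<psi>[of i v r w] x0 e0[of i] by (simp add: x m_simps)
    have fk: "r *\<^sub>R f k + w $ k *\<^sub>R u = 0" for k
      using f\<psi>[of k v r w] x0 by (simp add: x m_simps)
    have w: "w $ k = 0" for k
    proof -
      obtain l where l: "l \<noteq> k"
        using two by (metis (full_types) UNIV_I card_1_singleton_iff card_2_iff' ex_card)
      have "w $ k *\<^sub>R f l = m (f l) (r *\<^sub>R f k + w $ k *\<^sub>R u)"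
        using l by (simp add: m_simps ff fu)
      then have "w $ k *\<^sub>R m (f l) (f l) = 0"
        by (metis fk m_simps(4,6))
      then show ?thesis by (simp add: ff u0)
    qed
    have "r *\<^sub>R u = 0" using u\<psi>[of v r w] x0 by (simp add: x m_simps w)
    then show "x = 0" using u0 w \<open>\<And>i. v $ i = 0\<close> by (simp add: x vec_eq_iff zero_prod_def)
  qed
  moreover have "acarrier ?B = UNIV"
    by (auto simp: direct_sum_def copies_def real_alg_def spin_alg_def)
  moreover have "range \<psi> = span (range e \<union> {u} \<union> range f)"
  proof (rule antisym)
    show "range \<psi> \<subseteq> span (range e \<union> {u} \<union> range f)"
      by (auto simp: \<psi>_def intro!: span_add span_sum span_scale intro: span_base)
    have "e i = \<psi> (axis i 1, 0, 0)" "u = \<psi> (0, 1, 0)" "f j = \<psi> (0, 0, axis j 1)" for i j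
      by (simp_all add: \<psi>_def axis_def if_distrib[of "\<lambda>c. c *\<^sub>R _"] cong: if_cong)
    then have "range e \<union> {u} \<union> range f \<subseteq> range \<psi>" by blast
    then show "span (range e \<union> {u} \<union> range f) \<subseteq> range \<psi>"
      by (rule span_minimal) (rule linear_subspace_image[OF lin subspace_UNIV])
  qed
  ultimately show ?thesis
    using jordan_isomorphic_image[OF jordan lin, of m] mult by simp
qed

section \<open>Jordan schemes from partitions into \<open>0/1\<close>-matrices\<close>

text \<open>
  Each position carries the entry 1 in exactly one member of \<open>S\<close>. Hence, if \<open>A * B\<close> is a combination of
  members, the coefficient of \<open>C\<close> is the entry of \<open>A * B\<close> at any position where \<open>C\<close> has a 1, and twice this
  entry is an entry of the integral matrix \<open>A B + B A\<close>.
\<close>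

lemma jordan_schemeI:
  fixes S :: "(complex, 'x::finite) sqmat set"
  assumes fin: "finite S" and one: "mat 1 \<in> S"
    and symm: "\<And>A. A \<in> S \<Longrightarrow> transpose A = A"
    and entries: "\<And>A i j. A \<in> S \<Longrightarrow> A $ i $ j \<in> {0, 1}"
    and part: "\<And>i j. \<exists>!A. A \<in> S \<and> A $ i $ j = 1"
    and nonzero: "0 \<notin> S"
    and closed: "\<And>A B. A \<in> S \<Longrightarrow> B \<in> S \<Longrightarrow> jordan_prod A B \<in> span S"
  shows "jordan_scheme S"
proof -
  have entry: "(\<Sum>C\<in>S. p C *\<^sub>R C) $ i $ j = of_real (p A)"
    if A: "A \<in> S" "A $ i $ j = 1" for p A i j
  proof -
    have "C $ i $ j = (if C = A then 1 else 0)" if "C \<in> S" for C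
      using part[of i j] A that entries[of C i j] by auto
    then have "(\<Sum>C\<in>S. p C *\<^sub>R C $ i $ j) = (\<Sum>C\<in>S. if C = A then of_real (p A) else 0)"
      by (intro sum.cong) (auto simp: scaleR_conv_of_real)
    then show ?thesis using fin A(1) by simp
  qed
  have "(\<Sum>A\<in>S. A) = all_one"
  proof -
    have "(\<Sum>A\<in>S. A) $ i $ j = all_one $ i $ j" for i j
      using part[of i j] entry[of _ i j "\<lambda>_. 1"] by (auto simp: all_one_def)
    then show ?thesis by (simp add: vec_eq_iff)
  qed
  moreover have "\<exists>p. (\<forall>C\<in>S. 2 * p C \<in> \<int>) \<and> jordan_prod A B = (\<Sum>C\<in>S. p C *\<^sub>R C)"
    if AB: "A \<in> S" "B \<in> S" for A B
  proof -
    obtain p where p: "jordan_prod A B = (\<Sum>C\<in>S. p C *\<^sub>R C)"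
      using closed[OF AB] span_finite[OF fin] by auto
    have "2 * p C \<in> \<int>" if C: "C \<in> S" for C
    proof -
      obtain i j where ij: "C $ i $ j = 1"
        using nonzero C entries[OF C] by (metis empty_iff insert_iff vec_eq_iff zero_index)
      have ints: "D $ k $ l \<in> \<int>" if "D \<in> S" for D k l using entries[OF that, of k l] by auto
      have double: "2 * ((1/2) *\<^sub>R z) = z" for z :: complex by (simp add: scaleR_conv_of_real)
      have "complex_of_real (2 * p C) = 2 * jordan_prod A B $ i $ j"
        using entry[OF C ij] p by simp
      also have "\<dots> = (\<Sum>k\<in>UNIV. A $ i $ k * B $ k $ j) + (\<Sum>k\<in>UNIV. B $ i $ k * A $ k $ j)"
        by (simp add: jordan_prod_def matrix_matrix_mult_def double
              del: mult_scaleR_right distrib_left_numeral)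
      also have "\<dots> \<in> \<int>" by (intro Ints_add Ints_sum Ints_mult ints AB)
      finally obtain z where "complex_of_real (2 * p C) = of_int z" by (rule Ints_cases)
      then have "2 * p C = of_int z" by (metis of_real_eq_iff of_real_of_int_eq)
      then show ?thesis by simp
    qed
    with p show ?thesis by blast
  qed
  ultimately show ?thesis
    unfolding jordan_scheme_def using fin one symm entries by blast
qed

section \<open>Characters of elementary abelian 2-groups\<close>

text \<open>
  In a group of exponent 2 all complex characters take their values in \<open>{1, -1}\<close>, so these are all of them.
\<close>

definition characters :: "('h::{finite, ab_group_add} \<Rightarrow> real) set" where
  "characters = {\<theta>. (\<forall>x. \<theta> x \<in> {1, -1}) \<and> (\<forall>x y. \<theta> (x + y) = \<theta> x * \<theta> y)}"

lemma finite_characters: "finite (characters :: ('h::{finite, ab_group_add} \<Rightarrow> real) set)"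
proof (rule finite_subset)
  show "characters \<subseteq> (\<Pi>\<^sub>E x\<in>(UNIV::'h set). {1, -1::real})"
    by (auto simp: characters_def PiE_def)
qed (auto intro: finite_PiE)

lemma character_square: "\<theta> \<in> characters \<Longrightarrow> \<theta> x * \<theta> x = 1"
  unfolding characters_def by (auto dest!: conjunct1 spec[of _ x])

lemma character_zero: "\<theta> \<in> characters \<Longrightarrow> \<theta> 0 = 1"
proof -
  assume "\<theta> \<in> characters"
  then have "\<theta> (0 + 0) = \<theta> 0 * \<theta> 0" unfolding characters_def by blast
  with character_square[OF \<open>\<theta> \<in> characters\<close>, of 0] show "\<theta> 0 = 1" by simp
qed

lemma trivial_character: "(\<lambda>_. 1) \<in> characters"
  by (simp add: characters_def)

lemma characters_mult:
  "\<theta> \<in> characters \<Longrightarrow> \<eta> \<in> characters \<Longrightarrow> (\<lambda>x. \<theta> x * \<eta> x) \<in> characters"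
proof -
  assume "\<theta> \<in> characters" "\<eta> \<in> characters"
  then have "\<theta> x * \<eta> x \<in> {1, -1}" for x
    unfolding characters_def by (auto dest!: spec[of _ x])
  then show ?thesis
    using \<open>\<theta> \<in> characters\<close> \<open>\<eta> \<in> characters\<close> by (simp add: characters_def)
qed

text \<open>Translation by an element where \<open>\<theta>\<close> is \<open>-1\<close> permutes the group and negates the sum.\<close>

lemma sum_character:
  fixes \<theta> :: "'h::{finite, ab_group_add} \<Rightarrow> real"
  assumes "\<theta> \<in> characters"
  shows "(\<Sum>x\<in>UNIV. \<theta> x) = (if \<theta> = (\<lambda>_. 1) then of_nat CARD('h) else 0)"
proof (cases "\<theta> = (\<lambda>_. 1)")
  case False
  then obtain a where "\<theta> a \<noteq> 1" by auto
  then have a: "\<theta> a = -1" using assms by (auto simp: characters_def)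
  have "(\<Sum>x\<in>UNIV. \<theta> x) = (\<Sum>x\<in>UNIV. \<theta> (a + x))"
    by (rule sum.reindex_bij_witness[of _ "\<lambda>x. a + x" "\<lambda>x. x - a"]) auto
  also have "\<dots> = - (\<Sum>x\<in>UNIV. \<theta> x)"
    using assms a by (simp add: characters_def sum_negf)
  finally show ?thesis using False by simp
qed simp

lemma characters_orthogonal:
  fixes \<theta> \<eta> :: "'h::{finite, ab_group_add} \<Rightarrow> real"
  assumes "\<theta> \<in> characters" "\<eta> \<in> characters"
  shows "(\<Sum>x\<in>UNIV. \<theta> x * \<eta> x) = (if \<theta> = \<eta> then of_nat CARD('h) else 0)"
proof -
  have "(\<lambda>x. \<theta> x * \<eta> x) = (\<lambda>_. 1) \<longleftrightarrow> \<theta> = \<eta>"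
  proof
    assume *: "(\<lambda>x. \<theta> x * \<eta> x) = (\<lambda>_. 1)"
    show "\<theta> = \<eta>"
    proof
      fix x
      have "\<eta> x * \<eta> x = \<theta> x * \<eta> x" using fun_cong[OF *, of x] character_square[OF assms(2), of x] by simp
      then show "\<theta> x = \<eta> x" using character_square[OF assms(2), of x]
        by (metis mult_right_cancel mult_zero_right zero_neq_one)
    qed
  qed (simp add: character_square assms)
  then show ?thesis using sum_character[OF characters_mult[OF assms]] by simp
qed

text \<open>
  Take a subgroup \<open>U\<close> that is maximal among those not containing \<open>a\<close>. For \<open>y \<notin> U\<close> the subgroup
  \<open>U \<union> (y + U)\<close> contains \<open>a\<close>, so \<open>y \<in> a + U\<close>. Thus \<open>U\<close> has index 2, and the character that is 1 on \<open>U\<close>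
  and \<open>-1\<close> off \<open>U\<close> separates \<open>a\<close> from \<open>0\<close>.
\<close>

lemma separating_character:
  fixes a :: "'h::{finite, ab_group_add}"
  assumes two: "\<And>x::'h. x + x = 0" and "a \<noteq> 0"
  obtains \<theta> where "\<theta> \<in> characters" "\<theta> a = -1"
proof -
  define \<U> where "\<U> = {U :: 'h set. 0 \<in> U \<and> (\<forall>x\<in>U. \<forall>y\<in>U. x + y \<in> U) \<and> a \<notin> U}"
  have "finite \<U>" "{0} \<in> \<U>" using \<open>a \<noteq> 0\<close> by (auto simp: \<U>_def)
  then obtain U where U: "U \<in> \<U>" and max: "\<And>V. V \<in> \<U> \<Longrightarrow> U \<subseteq> V \<Longrightarrow> U = V"
    using finite_has_maximal[of \<U>] by (metis empty_iff)
  have U0: "0 \<in> U" and Uadd: "\<And>x y. x \<in> U \<Longrightarrow> y \<in> U \<Longrightarrow> x + y \<in> U" and aU: "a \<notin> U"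
    using U by (auto simp: \<U>_def)
  have cancel: "x + (x + y) = y" for x y :: 'h
    using two[of x] by (metis add.assoc add_0)
  have coset: "a + y \<in> U" if "y \<notin> U" for y
  proof (rule ccontr)
    assume n: "a + y \<notin> U"
    \<comment> \<open>\<open>?V\<close> is the subgroup generated by \<open>U\<close> and \<open>y\<close>; were \<open>a\<close> not in it, it would contradict maximality.\<close>
    let ?V = "U \<union> (\<lambda>x. y + x) ` U"
    have "a \<notin> ?V" using aU n cancel[of y] by (metis Un_iff add.commute imageE)
    moreover have "p + q \<in> ?V" if "p \<in> ?V" "q \<in> ?V" for p q
    proof -
      have "(y + v) + (y + w) = v + w" for v w using cancel[of y "v + w"] by (simp add: algebra_simps)
      then show ?thesis using that Uadd
        by (auto simp: image_iff algebra_simps)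
    qed
    ultimately have "?V \<in> \<U>" using U0 unfolding \<U>_def by blast
    then have "U = ?V" using max by blast
    moreover have "y \<in> ?V" using U0 by (auto simp: image_iff)
    ultimately show False using that by blast
  qed
  define \<theta> where "\<theta> = (\<lambda>x. if x \<in> U then 1 else -1 :: real)"
  have in1: "x + y \<in> U \<longleftrightarrow> y \<in> U" if "x \<in> U" for x y
    using Uadd[OF that] cancel[of x y] by metis
  have in2: "x + y \<in> U" if "x \<notin> U" "y \<notin> U" for x y
  proof -
    have "(a + x) + (a + y) \<in> U" using coset that Uadd by blast
    moreover have "(a + x) + (a + y) = x + y" using cancel[of a "x + y"] by (simp add: algebra_simps)
    ultimately show ?thesis by simp
  qed
  have "\<theta> (x + y) = \<theta> x * \<theta> y" for x y
    using in1[of x y] in1[of y x] in2[of x y] by (auto simp: \<theta>_def add.commute)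
  then have "\<theta> \<in> characters" by (auto simp: characters_def \<theta>_def)
  moreover have "\<theta> a = -1" using aU by (simp add: \<theta>_def)
  ultimately show thesis by (rule that)
qed

text \<open>
  Multiplication by a character \<open>\<eta>\<close> with \<open>\<eta> a = -1\<close> permutes the characters and negates the sum.
\<close>

lemma sum_over_characters_nonzero:
  fixes a :: "'h::{finite, ab_group_add}"
  assumes "\<And>x::'h. x + x = 0" and "a \<noteq> 0"
  shows "(\<Sum>\<theta>\<in>characters. \<theta> a) = 0"
proof -
  obtain \<eta> where \<eta>: "\<eta> \<in> characters" "\<eta> a = -1"
    using separating_character[OF assms] .
  have inv: "(\<lambda>x. \<eta> x * (\<eta> x * \<theta> x)) = \<theta>" for \<theta>
    by (simp add: mult.assoc[symmetric] character_square[OF \<eta>(1)])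
  have "(\<Sum>\<theta>\<in>characters. \<theta> a) = (\<Sum>\<theta>\<in>characters. \<eta> a * \<theta> a)"
    by (rule sum.reindex_bij_witness[of _ "\<lambda>\<theta> x. \<eta> x * \<theta> x" "\<lambda>\<theta> x. \<eta> x * \<theta> x"])
      (use \<eta>(1) in \<open>simp_all add: characters_mult inv mult.assoc[symmetric] character_square\<close>)
  also have "\<dots> = - (\<Sum>\<theta>\<in>characters. \<theta> a)" by (simp add: \<eta>(2) sum_negf)
  finally show ?thesis by simp
qed

text \<open>Sum \<open>\<theta> x\<close> over all \<open>\<theta>\<close> and \<open>x\<close> in both orders.\<close>

lemma card_characters:
  assumes two: "\<And>x::'h::{finite, ab_group_add}. x + x = 0"
  shows "card (characters :: ('h \<Rightarrow> real) set) = CARD('h)"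
proof -
  let ?X = "characters :: ('h \<Rightarrow> real) set"
  have "real CARD('h) = (\<Sum>\<theta>\<in>?X. \<Sum>x\<in>UNIV. \<theta> x)"
    by (simp add: sum_character trivial_character finite_characters sum.delta cong: sum.cong)
  also have "\<dots> = (\<Sum>x\<in>UNIV. \<Sum>\<theta>\<in>?X. \<theta> x)" by (rule sum.swap)
  also have "\<dots> = (\<Sum>x::'h\<in>UNIV. if x = 0 then real (card ?X) else 0)"
    by (rule sum.cong) (auto simp: sum_over_characters_nonzero[OF two] character_zero)
  finally show ?thesis by simp
qed

lemma sum_over_characters:
  fixes a :: "'h::{finite, ab_group_add}"
  assumes two: "\<And>x::'h. x + x = 0"
  shows "(\<Sum>\<theta>\<in>characters. \<theta> a) = (if a = 0 then of_nat CARD('h) else 0)"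
  using sum_over_characters_nonzero[OF two] card_characters[where 'h='h] two
  by (auto simp: character_zero)

section \<open>Kronecker products and the Jordan product\<close>

lemma kronecker_entry [simp]: "(A \<otimes>\<^sub>K B) $ (i, k) $ (j, l) = A $ i $ j * B $ k $ l"
  by (simp add: kronecker_def)

lemma kronecker_mult:
  fixes A C :: "(complex, 'a::finite) sqmat" and B D :: "(complex, 'b::finite) sqmat"
  shows "(A \<otimes>\<^sub>K B) ** (C \<otimes>\<^sub>K D) = (A ** C) \<otimes>\<^sub>K (B ** D)"
proof -
  have pairs: "(\<Sum>p\<in>UNIV. F p) = (\<Sum>a\<in>UNIV. \<Sum>b\<in>UNIV. F (a, b))"
    for F :: "'a \<times> 'b \<Rightarrow> complex"
    using sum.cartesian_product'[of F UNIV UNIV] by simp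
  show ?thesis
    by (simp add: vec_eq_iff split_paired_all matrix_matrix_mult_def pairs sum_product mult_ac)
qed

lemma kronecker_add_left: "(A + B) \<otimes>\<^sub>K C = A \<otimes>\<^sub>K C + B \<otimes>\<^sub>K C"
  and kronecker_scaleR_left: "(r *\<^sub>R A) \<otimes>\<^sub>K C = r *\<^sub>R (A \<otimes>\<^sub>K C)"
  and kronecker_scaleR_right: "A \<otimes>\<^sub>K (r *\<^sub>R C) = r *\<^sub>R (A \<otimes>\<^sub>K C)"
  by (simp_all add: kronecker_def vec_eq_iff algebra_simps)

lemma kronecker_sum_left: "(\<Sum>i\<in>I. A i) \<otimes>\<^sub>K C = (\<Sum>i\<in>I. A i \<otimes>\<^sub>K C)"
  by (simp add: kronecker_def vec_eq_iff sum_distrib_right)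

lemma kronecker_zero: "0 \<otimes>\<^sub>K C = 0" "A \<otimes>\<^sub>K 0 = 0"
  by (simp_all add: kronecker_def vec_eq_iff)

lemma bilinear_jordan_prod: "bilinear jordan_prod"
  unfolding bilinear_def jordan_prod_def
  by (intro conjI allI linearI)
    (simp_all add: matrix_matrix_mult_def vec_eq_iff algebra_simps sum.distrib scaleR_sum_right)

lemma jordan_prod_commute: "jordan_prod A B = jordan_prod B A"
  by (simp add: jordan_prod_def add.commute)

text \<open>
  If the second factors commute, the Jordan product is computed in the first factors. For \<open>J\<^sub>2\<close> and \<open>D\<^sub>2\<close> this
  reduces the adjacency algebra to matrices indexed by \<open>H\<close>.
\<close>

lemma jordan_prod_kronecker:
  assumes "C ** D = c *\<^sub>R E" "D ** C = c *\<^sub>R E"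
  shows "jordan_prod (A \<otimes>\<^sub>K C) (B \<otimes>\<^sub>K D) = c *\<^sub>R (jordan_prod A B \<otimes>\<^sub>K E)"
  by (simp add: jordan_prod_def kronecker_mult assms kronecker_add_left kronecker_scaleR_left
      kronecker_scaleR_right scaleR_add_right mult.commute)

lemma jordan_prod_kronecker_zero:
  assumes "C ** D = 0" "D ** C = 0"
  shows "jordan_prod (A \<otimes>\<^sub>K C) (B \<otimes>\<^sub>K D) = 0"
  by (simp add: jordan_prod_def kronecker_mult assms kronecker_zero)

definition D2 :: "(complex, 2) sqmat" where "D2 = I2 - K2"

lemma J2_J2: "J2 ** J2 = 2 *\<^sub>R J2"
  and D2_D2: "D2 ** D2 = 2 *\<^sub>R D2"
  and J2_D2: "J2 ** D2 = 0" and D2_J2: "D2 ** J2 = 0"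
  by (simp_all add: J2_def D2_def K2_def I2_def all_one_def mat_def matrix_matrix_mult_def
      vec_eq_iff forall_2 UNIV_2 scaleR_conv_of_real[where 'a=complex])

section \<open>Translation matrices and characters\<close>

text \<open>
  The rank one matrix \<open>\<theta> \<theta>\<^sup>T\<close>; divided by the group order, for a character \<open>\<theta>\<close> it is the projection onto the line of
  \<open>\<theta>\<close>, a common eigenvector of all translations.
\<close>

definition char_mat :: "('h::{finite, ab_group_add} \<Rightarrow> real) \<Rightarrow> (complex, 'h) sqmat" where
  "char_mat \<theta> = (\<chi> x y. of_real (\<theta> x * \<theta> y))"

definition translation :: "'h::{finite, ab_group_add} \<Rightarrow> (complex, 'h) sqmat" where
  "translation h = (\<chi> x y. if y = x + h then 1 else 0)"

lemma char_mat_mult: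
  fixes \<theta> \<eta> :: "'h::{finite, ab_group_add} \<Rightarrow> real"
  assumes "\<theta> \<in> characters" "\<eta> \<in> characters"
  shows "char_mat \<theta> ** char_mat \<eta> = (if \<theta> = \<eta> then real CARD('h) *\<^sub>R char_mat \<theta> else 0)"
proof -
  have "(char_mat \<theta> ** char_mat \<eta>) $ x $ y =
      (if \<theta> = \<eta> then real CARD('h) *\<^sub>R char_mat \<theta> else 0) $ x $ y" for x y
  proof -
    have "(char_mat \<theta> ** char_mat \<eta>) $ x $ y = of_real (\<theta> x * \<eta> y * (\<Sum>k\<in>UNIV. \<theta> k * \<eta> k))"
      by (simp add: char_mat_def matrix_matrix_mult_def sum_distrib_left mult_ac)
    then show ?thesis
      by (simp only: characters_orthogonal[OF assms])
        (simp add: char_mat_def scaleR_conv_of_real[where 'a=complex] mult_ac)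
  qed
  then show ?thesis by (simp add: vec_eq_iff)
qed

text \<open>
  This is the Fourier transform, and the next lemma is its inverse; in a group of exponent 2, the translations
  and the matrices of characters therefore have the same span.
\<close>

lemma char_mat_eq_sum_translation:
  fixes \<theta> :: "'h::{finite, ab_group_add} \<Rightarrow> real"
  assumes \<theta>: "\<theta> \<in> characters"
  shows "char_mat \<theta> = (\<Sum>h\<in>UNIV. \<theta> h *\<^sub>R translation h)"
proof -
  have "(\<Sum>h\<in>UNIV. \<theta> h *\<^sub>R translation h) $ x $ y = char_mat \<theta> $ x $ y" for x y :: 'h
  proof -
    have 1: "\<theta> y = \<theta> x * \<theta> (y - x)"
    proof -
      have "\<theta> (x + (y - x)) = \<theta> x * \<theta> (y - x)" using \<theta> unfolding characters_def by blast
      then show ?thesis by simp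
    qed
    have 2: "(y = x + h) = (h = y - x)" for h by (auto simp: algebra_simps)
    have "(\<Sum>h\<in>UNIV. \<theta> h *\<^sub>R translation h) $ x $ y = of_real (\<theta> (y - x))"
      by (simp add: translation_def scaleR_conv_of_real[where 'a=complex] if_distrib 2 cong: if_cong)
    also have "\<dots> = of_real (\<theta> x * \<theta> x * \<theta> (y - x))" by (simp add: character_square[OF \<theta>])
    also have "\<dots> = char_mat \<theta> $ x $ y" using 1 by (simp add: char_mat_def mult_ac)
    finally show ?thesis .
  qed
  then show ?thesis by (simp add: vec_eq_iff)
qed

lemma translation_eq_sum_char_mat:
  fixes h :: "'h::{finite, ab_group_add}"
  assumes two: "\<And>x::'h. x + x = 0"
  shows "real CARD('h) *\<^sub>R translation h = (\<Sum>\<theta>\<in>characters. \<theta> h *\<^sub>R char_mat \<theta>)"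
proof -
  have "(\<Sum>\<theta>\<in>characters. \<theta> h *\<^sub>R char_mat \<theta>) $ x $ y = (real CARD('h) *\<^sub>R translation h) $ x $ y" for x y :: 'h
  proof -
    have "(\<Sum>\<theta>\<in>characters. \<theta> h *\<^sub>R char_mat \<theta>) $ x $ y = of_real (\<Sum>\<theta>\<in>characters. \<theta> (h + (x + y)))"
      by (auto simp: char_mat_def characters_def scaleR_conv_of_real[where 'a=complex] intro!: sum.cong)
    moreover have "h + (x + y) = 0 \<longleftrightarrow> y = x + h"
      by (metis two add.assoc add.commute add_left_imp_eq)
    ultimately show ?thesis
      by (simp add: sum_over_characters[OF two] translation_def scaleR_conv_of_real[where 'a=complex])
  qed
  then show ?thesis by (simp add: vec_eq_iff)
qed

section \<open>Entries of the matrices of the scheme\<close>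

lemma two_cases: "(a::2) = 0 \<or> a = 1"
  using exhaust_2[of a] by auto

lemma two_add_self: "(a::2) + a = 0"
  using two_cases[of a] by auto

text \<open>
  A pair of positions \<open>(x, y)\<close> lies in the support of exactly one translation, namely that by \<open>x + y\<close>.
\<close>

lemma add_eq_iff_exponent_2:
  fixes x y h :: "'h::ab_group_add"
  assumes two: "\<And>x::'h. x + x = 0"
  shows "y = x + h \<longleftrightarrow> h = x + y"
  by (metis two add.assoc add_0)

lemma pair_add_self:
  assumes "\<forall>x::'g::ab_group_add. x + x = 0"
  shows "(p :: 2 \<times> 'g) + p = 0"
  using assms two_add_self by (simp add: prod_eq_iff)

lemma pair_translate_iff:
  fixes p q h :: "2 \<times> 'g::ab_group_add"
  assumes "\<forall>x::'g. x + x = 0"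
  shows "q = p + h \<longleftrightarrow> h = p + q"
  by (rule add_eq_iff_exponent_2) (rule pair_add_self[OF assms])

text \<open>
  The sign of the pair \<open>p, q \<in> H\<close>: an entry of \<open>M\<close> if \<open>p\<close> and \<open>q\<close> lie in different cosets of \<open>G\<close>, with row
  index from the coset of \<open>0\<close>. The value 1 within a coset makes \<open>\<sigma>\<^bsub>(0,0)\<^esub>\<close> and \<open>\<sigma>'\<^bsub>(0,0)\<^esub>\<close> obey the
  same rule as \<open>\<sigma>\<^bsub>(1,t)\<^esub>\<close> and \<open>\<sigma>'\<^bsub>(1,t)\<^esub>\<close>.
\<close>

definition edge_sign :: "(int, 'g::finite) sqmat \<Rightarrow> 2 \<times> 'g \<Rightarrow> 2 \<times> 'g \<Rightarrow> int" where
  "edge_sign M p q =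
    (if fst p = fst q then 1 else if fst p = 0 then M $ snd p $ snd q else M $ snd q $ snd p)"

lemma edge_sign_commute: "edge_sign M p q = edge_sign M q p"
  using two_cases[of "fst p"] two_cases[of "fst q"] by (auto simp: edge_sign_def)

lemma edge_sign_cases:
  assumes "admissible M"
  shows "edge_sign M p q = 1 \<or> edge_sign M p q = -1"
  using assms by (auto simp: edge_sign_def admissible_def)

text \<open>
  Both \<open>\<sigma>\<close> and \<open>\<sigma>'\<close> have this shape; the order of the arguments of \<open>L\<close> depends on the coset of the row.
\<close>

lemma block_entry:
  fixes L :: "'g::{finite, ab_group_add} \<Rightarrow> 'g \<Rightarrow> (complex, 2) sqmat" and a b :: 2
  shows "((\<Sum>g\<in>UNIV. matrix_unit (0, g) (s, g + t) \<otimes>\<^sub>K L g (g + t)) +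
      (\<Sum>g\<in>UNIV. matrix_unit (1, g) (1 + s, g + t) \<otimes>\<^sub>K L (g + t) g)) $ ((a, x), i) $ ((b, y), j) =
    (if (b, y) = (a, x) + (s, t) then (if a = 0 then L x y else L y x) $ i $ j else 0)"
proof -
  have sum_at: "(\<Sum>g\<in>UNIV. matrix_unit (d, g) (c, g + t) $ (a, x) $ (b, y) * K g) =
      (if d = a \<and> b = c \<and> y = x + t then K x else 0)" for c d :: 2 and K :: "'g \<Rightarrow> complex"
  proof -
    have "matrix_unit (d, g) (c, g + t) $ (a, x) $ (b, y) * K g =
        (if g = x then if d = a \<and> b = c \<and> y = x + t then K x else 0 else 0)" for g
      by (auto simp: matrix_unit_def)
    then show ?thesis by simp
  qed
  show ?thesis
    using two_cases[of a] by (auto simp: sum_at)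
qed

text \<open>
  Where the blocks of \<open>\<sigma>\<close> are not \<open>J\<^sub>2\<close>, they are \<open>I\<^sub>2\<close> for the sign 1 and \<open>K\<^sub>2\<close> for the sign \<open>-1\<close>, and
  the blocks of \<open>\<sigma>'\<close> are the opposite ones. So \<open>\<sigma>\<close> has its entries 1 at the pairs that agree, and \<open>\<sigma>'\<close>
  at those that do not.
\<close>

definition agree :: "(int, 'g::finite) sqmat \<Rightarrow> (2 \<times> 'g) \<times> 2 \<Rightarrow> (2 \<times> 'g) \<times> 2 \<Rightarrow> bool" where
  "agree M P Q \<longleftrightarrow> (snd P = snd Q \<longleftrightarrow> edge_sign M (fst P) (fst Q) = 1)"

lemma agree_commute: "agree M P Q = agree M Q P"
  by (auto simp: agree_def edge_sign_commute)

lemma K2_K2: "K2 ** K2 = I2"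
  and J2_entry: "J2 $ i $ j = 1"
  and I2_entry: "I2 $ i $ j = (if i = j then 1 else 0)"
  and K2_entry: "K2 $ i $ j = (if i = j then 0 else 1)"
  by (simp_all add: J2_def K2_def I2_def all_one_def mat_def matrix_matrix_mult_def vec_eq_iff forall_2 UNIV_2)

lemma I2_K2: "I2 ** K2 = K2"
  by (simp add: I2_def)

text \<open>
  The alternative \<open>fst h = 0 \<and> h \<noteq> 0\<close> describes the matrices \<open>\<sigma>\<^bsub>(0,t)\<^esub>\<close>, \<open>t \<noteq> 0\<close>, whose blocks are \<open>J\<^sub>2\<close>
  and which have no companion \<open>\<sigma>'\<close> in the scheme.
\<close>

lemma sigma_entry:
  assumes two: "\<forall>x::'g::{finite, ab_group_add}. x + x = 0"
  shows "sigma (M :: (int, 'g) sqmat) h $ P $ Q =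
    (if h = fst P + fst Q \<and> (agree M P Q \<or> (fst h = 0 \<and> h \<noteq> 0)) then 1 else 0)"
proof -
  obtain s t a x i b y j where eqs: "h = (s, t)" "P = ((a, x), i)" "Q = ((b, y), j)"
    by (metis surj_pair)
  have "(b, y) = (a, x) + (s, t) \<longleftrightarrow> h = fst P + fst Q"
    unfolding eqs fst_conv by (rule pair_translate_iff[OF two])
  moreover have "sigma M h $ P $ Q = (if (b, y) = (a, x) + (s, t) then (if a = 0 then Lmat M (s, t) x y else Lmat M (s, t) y x) $ i $ j else 0)"
    unfolding sigma_def eqs prod.case by (rule block_entry)
  moreover have "(if a = 0 then Lmat M (s, t) x y else Lmat M (s, t) y x) $ i $ j = (if agree M P Q \<or> (fst h = 0 \<and> h \<noteq> 0) then 1 else 0)"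
    if "h = fst P + fst Q"
  proof -
    have st: "s = a + b" "t = x + y" using that by (simp_all add: eqs)
    consider "a = 0" "b = 0" | "a = 0" "b = 1" | "a = 1" "b = 0" | "a = 1" "b = 1"
      using two_cases[of a] two_cases[of b] by blast
    then show ?thesis
      using st by cases (simp_all add: eqs Lmat_def agree_def edge_sign_def zero_prod_def J2_entry I2_entry K2_entry)
  qed
  ultimately show ?thesis by simp
qed

lemma sigma'_entry:
  assumes two: "\<forall>x::'g::{finite, ab_group_add}. x + x = 0" and h: "h = 0 \<or> fst h = 1"
  shows "sigma' (M :: (int, 'g) sqmat) h $ P $ Q =
    (if h = fst P + fst Q \<and> \<not> agree M P Q then 1 else 0)"
proof -
  obtain s t a x i b y j where eqs: "h = (s, t)" "P = ((a, x), i)" "Q = ((b, y), j)"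
    by (metis surj_pair)
  have "(b, y) = (a, x) + (s, t) \<longleftrightarrow> h = fst P + fst Q"
    unfolding eqs fst_conv by (rule pair_translate_iff[OF two])
  moreover have "sigma' M h $ P $ Q = (if (b, y) = (a, x) + (s, t) then (if a = 0 then Lmat M (s, t) x y ** K2 else Lmat M (s, t) y x ** K2) $ i $ j else 0)"
    unfolding sigma'_def eqs prod.case by (rule block_entry)
  moreover have "(if a = 0 then Lmat M (s, t) x y ** K2 else Lmat M (s, t) y x ** K2) $ i $ j = (if \<not> agree M P Q then 1 else 0)"
    if "h = fst P + fst Q"
  proof -
    have st: "s = a + b" "t = x + y" using that by (simp_all add: eqs)
    consider "a = 0" "b = 0" | "a = 0" "b = 1" | "a = 1" "b = 0" | "a = 1" "b = 1"
      using two_cases[of a] two_cases[of b] by blast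
    then show ?thesis
      using h st by cases (simp_all add: eqs Lmat_def agree_def edge_sign_def zero_prod_def I2_K2 K2_K2 I2_entry K2_entry)
  qed
  ultimately show ?thesis by simp
qed

lemma scheme_eq: "scheme M = range (sigma M) \<union> sigma' M ` {h. h = 0 \<or> fst h = 1}"
proof -
  have "range (sigma M) = {sigma M (0, 0)} \<union> {sigma M (0, t) | t. t \<noteq> 0} \<union> {sigma M (1, t) | t. True}"
  proof -
    have "sigma M h \<in> {sigma M (0, 0)} \<union> {sigma M (0, t) | t. t \<noteq> 0} \<union> {sigma M (1, t) | t. True}" for h
      using two_cases[of "fst h"] by (cases h) auto
    then show ?thesis by auto
  qed
  moreover have "sigma' M ` {h. h = 0 \<or> fst h = 1} = {sigma' M (0, 0)} \<union> {sigma' M (1, t) | t. True}"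
    by (auto simp: zero_prod_def image_iff)
  ultimately show ?thesis unfolding scheme_def by auto
qed

lemma scheme_cases [consumes 1, case_names sigma sigma']:
  assumes "A \<in> scheme M"
  obtains h where "A = sigma M h" | h where "h = 0 \<or> fst h = 1" "A = sigma' M h"
  using assms unfolding scheme_eq by blast

text \<open>
  The group parts of the two points determine \<open>h\<close>, and agreement of the points decides between \<open>\<sigma>\<^sub>h\<close> and \<open>\<sigma>'\<^sub>h\<close>.
\<close>

lemma scheme_is_partition:
  assumes two: "\<forall>x::'g::{finite, ab_group_add}. x + x = 0"
  shows "\<exists>!A. A \<in> scheme (M :: (int, 'g) sqmat) \<and> A $ P $ Q = 1"
proof -
  let ?h = "fst P + fst Q"
  have s: "sigma M h $ P $ Q = 1 \<longleftrightarrow> h = ?h \<and> (agree M P Q \<or> (fst h = 0 \<and> h \<noteq> 0))" for h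
    by (auto simp: sigma_entry[OF two])
  have s': "sigma' M h $ P $ Q = 1 \<longleftrightarrow> h = ?h \<and> \<not> agree M P Q" if "h = 0 \<or> fst h = 1" for h
    by (auto simp: sigma'_entry[OF two that])
  show ?thesis
  proof (cases "agree M P Q \<or> (fst ?h = 0 \<and> ?h \<noteq> 0)")
    case True
    then have "sigma M ?h \<in> scheme M \<and> sigma M ?h $ P $ Q = 1" unfolding s scheme_eq by blast
    moreover have "A = sigma M ?h" if "A \<in> scheme M \<and> A $ P $ Q = 1" for A
      using that[THEN conjunct1]
    proof (cases rule: scheme_cases)
      case (sigma h)
      then have "h = ?h" using that s[of h] by simp
      then show ?thesis using sigma by simp
    next
      case (sigma' h)
      then have "h = ?h" "\<not> agree M P Q" using that s'[of h] by blast+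
      then show ?thesis using True sigma'(1) by auto
    qed
    ultimately show ?thesis by blast
  next
    case False
    then have h: "?h = 0 \<or> fst ?h = 1" using two_cases[of "fst ?h"] by blast
    then have "sigma' M ?h \<in> scheme M \<and> sigma' M ?h $ P $ Q = 1"
      using False s'[OF h] unfolding scheme_eq by blast
    moreover have "A = sigma' M ?h" if "A \<in> scheme M \<and> A $ P $ Q = 1" for A
      using that[THEN conjunct1]
    proof (cases rule: scheme_cases)
      case (sigma h)
      then show ?thesis using that s[of h] False by blast
    next
      case (sigma' h)
      then have "h = ?h" using that s'[of h] by simp
      then show ?thesis using sigma'(2) by simp
    qed
    ultimately show ?thesis by blast
  qed
qed

lemma zero_notin_scheme:
  assumes two: "\<forall>x::'g::{finite, ab_group_add}. x + x = 0"
  shows "0 \<notin> scheme (M :: (int, 'g) sqmat)"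
proof
  assume "0 \<in> scheme M"
  then show False
  proof (cases rule: scheme_cases)
    case (sigma h)
    define j :: 2 where "j = (if edge_sign M 0 h = 1 then 0 else 1)"
    have "sigma M h $ (0, 0) $ (h, j) = 1" by (simp add: sigma_entry[OF two] agree_def j_def)
    then show False using sigma by (metis zero_index zero_neq_one)
  next
    case (sigma' h)
    define j :: 2 where "j = (if edge_sign M 0 h = 1 then 1 else 0)"
    have "sigma' M h $ (0, 0) $ (h, j) = 1" by (simp add: sigma'_entry[OF two sigma'(1)] agree_def j_def)
    then show False using sigma'(2) by (metis zero_index zero_neq_one)
  qed
qed

section \<open>Clifford relations\<close>

text \<open>The signed translation that represents \<open>\<sigma>\<^bsub>(1,t)\<^esub>\<close> on the \<open>-1\<close>-eigenspace of \<open>K\<^sub>2\<close>.\<close>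

definition clifford :: "(int, 'g::{finite, ab_group_add}) sqmat \<Rightarrow> 'g \<Rightarrow> (complex, 2 \<times> 'g) sqmat" where
  "clifford M t = (\<chi> p q. if q = p + (1, t) then of_int (edge_sign M p q) else 0)"

text \<open>Each row of a signed translation has one nonzero entry, so the product is over a single path.\<close>

lemma clifford_mult_entry:
  "(clifford M t ** clifford M u) $ p $ q =
    (if q = p + (0, t + u) then of_int (edge_sign M p (p + (1, t)) * edge_sign M (p + (1, t)) q) else 0)"
proof -
  have "(clifford M t ** clifford M u) $ p $ q =
      (\<Sum>k\<in>UNIV. if k = p + (1, t) then of_int (edge_sign M p k) * clifford M u $ k $ q else 0)"
    by (simp only: matrix_matrix_mult_def vec_lambda_beta, intro sum.cong) (auto simp: clifford_def)
  moreover have "p + (1, t) + (1, u) = p + (0, t + u)"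
    by (cases p) (simp add: add.assoc)
  ultimately show ?thesis by (simp add: clifford_def)
qed

text \<open>
  From \<open>p\<close>, the entries of \<open>N\<^sub>t N\<^sub>u\<close> and of \<open>N\<^sub>u N\<^sub>t\<close> lead to the same point, along the two sides of a
  quadrangle. The condition on \<open>M\<close> says that the product of the four signs around the quadrangle is \<open>-1\<close>, so the two
  entries cancel.
\<close>

lemma clifford_relations:
  fixes M :: "(int, 'g::{finite, ab_group_add}) sqmat"
  assumes two: "\<forall>x::'g. x + x = 0" and adm: "admissible M"
  shows "jordan_prod (clifford M t) (clifford M u) = (if t = u then mat 1 else 0)"
proof (cases "t = u")
  case True
  have "edge_sign M p (p + (1, t)) * edge_sign M (p + (1, t)) p = 1" for p
    using edge_sign_cases[OF adm, of p "p + (1, t)"] by (auto simp: edge_sign_commute[of M "p + (1, t)"])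
  then have "clifford M t ** clifford M t = mat 1"
    using two by (auto simp: vec_eq_iff clifford_mult_entry mat_def zero_prod_def[symmetric]
        simp flip: of_int_mult)
  then show ?thesis by (simp add: True jordan_prod_def scaleR_2[symmetric])
next
  case False
  have sgn: "M $ x $ y = 1 \<or> M $ x $ y = -1" for x y
    using adm by (auto simp: admissible_def)
  have "edge_sign M p (p + (1, t)) * edge_sign M (p + (1, t)) (p + (0, t + u)) +
      edge_sign M p (p + (1, u)) * edge_sign M (p + (1, u)) (p + (0, t + u)) = 0" for p
  proof -
    obtain a x where p: "p = (a, x)" by (cases p)
    have cancel: "v + (v + w) = w" for v w :: 'g using two by (metis add.assoc add_0)
    \<comment> \<open>The quadrangle if \<open>p\<close> is a row index of \<open>M\<close>: rows \<open>x\<close> and \<open>x + t + u\<close>, shift \<open>t\<close>.\<close>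
    have rel: "M $ x $ (x + t) * M $ x $ (x + u) * M $ (x + (t + u)) $ (x + t) * M $ (x + (t + u)) $ (x + u) = -1"
    proof -
      have "x \<noteq> x + (t + u)" using False two by (metis add_cancel_left_right cancel add.right_neutral)
      moreover have "x + (t + u) + t = x + u" using cancel[of t "x + u"] by (simp add: algebra_simps)
      ultimately show ?thesis using adm unfolding admissible_def by metis
    qed
    \<comment> \<open>The quadrangle if \<open>p\<close> is a column index of \<open>M\<close>: rows \<open>x + t\<close> and \<open>x + u\<close>, shift \<open>t\<close>.\<close>
    have rel': "M $ (x + t) $ x * M $ (x + t) $ (x + (t + u)) * M $ (x + u) $ x * M $ (x + u) $ (x + (t + u)) = -1"
    proof -
      have "x + t \<noteq> x + u" using False by simp
      moreover have "x + t + t = x" "x + u + t = x + (t + u)" using cancel[of t x] by (simp_all add: algebra_simps)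
      ultimately show ?thesis using adm unfolding admissible_def by metis
    qed
    have cancel_signs: "k * m + l * n = 0"
      if "k * l * m * n = -1" "k = 1 \<or> k = -1" "l = 1 \<or> l = -1" "m = 1 \<or> m = -1" for k l m n :: int
      using that by auto
    have rel'': "M $ (x + t) $ x * M $ (x + u) $ x * M $ (x + t) $ (x + (t + u)) * M $ (x + u) $ (x + (t + u)) = -1"
      using rel' by (simp only: mult_ac)
    from two_cases[of a] show ?thesis
    proof
      assume "a = 0"
      then show ?thesis
        using cancel_signs[OF rel sgn sgn sgn] by (simp add: p edge_sign_def)
    next
      assume "a = 1"
      then show ?thesis
        using cancel_signs[OF rel'' sgn sgn sgn] by (simp add: p edge_sign_def)
    qed
  qed
  then have "(clifford M t ** clifford M u + clifford M u ** clifford M t) $ p $ q = 0" for p q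
    by (simp add: clifford_mult_entry add.commute[of u t] flip: of_int_add del: of_int_mult)
  then show ?thesis by (simp add: False jordan_prod_def vec_eq_iff)
qed

section \<open>The adjacency algebra of the scheme\<close>

lemma sigma_add_sigma':
  assumes two: "\<forall>x::'g::{finite, ab_group_add}. x + x = 0" and h: "h = 0 \<or> fst h = 1"
  shows "sigma (M :: (int, 'g) sqmat) h + sigma' M h = translation h \<otimes>\<^sub>K J2"
proof -
  have "\<not> (fst h = 0 \<and> h \<noteq> 0)" using h by auto
  moreover have "q = p + h \<longleftrightarrow> h = p + q" for p q
    by (rule pair_translate_iff[OF two])
  ultimately show ?thesis
    by (auto simp: vec_eq_iff sigma_entry[OF two] sigma'_entry[OF two h] translation_def J2_entry)
qed

lemma sigma_double:
  assumes two: "\<forall>x::'g::{finite, ab_group_add}. x + x = 0" and h: "fst h = 0" "h \<noteq> 0"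
  shows "sigma (M :: (int, 'g) sqmat) h = translation h \<otimes>\<^sub>K J2"
proof -
  have "q = p + h \<longleftrightarrow> h = p + q" for p q
    by (rule pair_translate_iff[OF two])
  then show ?thesis
    using h by (auto simp: vec_eq_iff sigma_entry[OF two] translation_def J2_entry)
qed

lemma sigma_diff_sigma'_0:
  assumes two: "\<forall>x::'g::{finite, ab_group_add}. x + x = 0"
  shows "sigma (M :: (int, 'g) sqmat) 0 - sigma' M 0 = mat 1 \<otimes>\<^sub>K D2"
proof -
  have "q = p + 0 \<longleftrightarrow> 0 = p + q" for p q :: "2 \<times> 'g"
    by (rule pair_translate_iff[OF two])
  then show ?thesis
    by (auto simp: vec_eq_iff sigma_entry[OF two] sigma'_entry[OF two] mat_def D2_def I2_entry K2_entry
        agree_def edge_sign_def)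
qed

lemma sigma_diff_sigma'_1:
  assumes two: "\<forall>x::'g::{finite, ab_group_add}. x + x = 0" and adm: "admissible M"
  shows "sigma (M :: (int, 'g) sqmat) (1, t) - sigma' M (1, t) = clifford M t \<otimes>\<^sub>K D2"
proof -
  have "q = p + (1, t) \<longleftrightarrow> (1, t) = p + q" for p q :: "2 \<times> 'g"
    by (rule pair_translate_iff[OF two])
  then have "(sigma M (1, t) - sigma' M (1, t)) $ P $ Q = (clifford M t \<otimes>\<^sub>K D2) $ P $ Q" for P Q
    using edge_sign_cases[OF adm, of "fst P" "fst Q"]
    by (cases P; cases Q) (auto simp: sigma_entry[OF two] sigma'_entry[OF two] clifford_def D2_def
        I2_entry K2_entry agree_def)
  then show ?thesis by (simp add: vec_eq_iff)
qed

lemma in_span_scaleR_iff: "k \<noteq> 0 \<Longrightarrow> k *\<^sub>R v \<in> span U \<longleftrightarrow> v \<in> span U"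
  using span_scale[of "k *\<^sub>R v" U "1 / k"] by (auto intro: span_scale)

text \<open>
  Passing from \<open>\<sigma>, \<sigma>'\<close> to their sum and difference is invertible, and so is the Fourier transform on \<open>H\<close>.
\<close>

lemma span_scheme:
  fixes M :: "(int, 'g::{finite, ab_group_add}) sqmat"
  assumes two: "\<forall>x::'g. x + x = 0" and adm: "admissible M"
  shows "span (scheme M) = span ((\<lambda>\<theta>. char_mat \<theta> \<otimes>\<^sub>K J2) ` characters \<union>
    {mat 1 \<otimes>\<^sub>K D2} \<union> range (\<lambda>t. clifford M t \<otimes>\<^sub>K D2))" (is "_ = span ?U")
proof (subst span_eq, rule conjI)
  have sig: "sigma M h \<in> span (scheme M)" for h
    by (auto simp: scheme_eq intro: span_base)
  have sig': "sigma' M h \<in> span (scheme M)" if "h = 0 \<or> fst h = 1" for h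
    using that by (auto simp: scheme_eq intro: span_base)
  have trans: "translation h \<otimes>\<^sub>K J2 \<in> span (scheme M)" for h :: "2 \<times> 'g"
  proof (cases "h = 0 \<or> fst h = 1")
    case True
    show ?thesis
      unfolding sigma_add_sigma'[OF two True, of M, symmetric] by (intro span_add sig sig' True)
  next
    case False
    then have "fst h = 0" "h \<noteq> 0" using two_cases[of "fst h"] by auto
    from sigma_double[OF two this, of M] show ?thesis using sig[of h] by simp
  qed
  have "char_mat \<theta> \<otimes>\<^sub>K J2 \<in> span (scheme M)" if "\<theta> \<in> characters" for \<theta> :: "2 \<times> 'g \<Rightarrow> real"
    unfolding char_mat_eq_sum_translation[OF that] kronecker_sum_left kronecker_scaleR_left
    by (intro span_sum span_scale trans)
  moreover have "mat 1 \<otimes>\<^sub>K D2 \<in> span (scheme M)"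
    unfolding sigma_diff_sigma'_0[OF two, of M, symmetric] by (intro span_diff sig sig') simp
  moreover have "clifford M t \<otimes>\<^sub>K D2 \<in> span (scheme M)" for t
    unfolding sigma_diff_sigma'_1[OF two adm, symmetric] by (intro span_diff sig sig') simp
  ultimately show "?U \<subseteq> span (scheme M)" by auto
next
  have trans: "translation h \<otimes>\<^sub>K J2 \<in> span ?U" for h :: "2 \<times> 'g"
  proof -
    have "real CARD(2 \<times> 'g) *\<^sub>R (translation h \<otimes>\<^sub>K J2) = (\<Sum>\<theta>\<in>characters. \<theta> h *\<^sub>R (char_mat \<theta> \<otimes>\<^sub>K J2))"
      unfolding kronecker_scaleR_left[symmetric] kronecker_sum_left[symmetric]
        translation_eq_sum_char_mat[OF pair_add_self[OF two]] ..
    also have "\<dots> \<in> span ?U"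
      by (intro span_sum span_scale span_base) blast
    finally show ?thesis by (simp add: in_span_scaleR_iff)
  qed
  have half: "sigma M h = (1/2) *\<^sub>R (a + b) \<and> sigma' M h = (1/2) *\<^sub>R (a - b)"
    if "sigma M h + sigma' M h = a" "sigma M h - sigma' M h = b" for h a b
    using that by (auto simp: scaleR_2[symmetric])
  have both: "sigma M h \<in> span ?U \<and> sigma' M h \<in> span ?U" if h: "h = 0 \<or> fst h = 1" for h
  proof -
    have "sigma M h - sigma' M h \<in> span ?U"
      using h
    proof
      assume "h = 0"
      then show ?thesis by (auto simp: sigma_diff_sigma'_0[OF two] intro: span_base)
    next
      assume "fst h = 1"
      then have "h = (1, snd h)" by (simp add: prod_eq_iff)
      then show ?thesis using sigma_diff_sigma'_1[OF two adm, of "snd h"] by (auto intro: span_base)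
    qed
    then show ?thesis
      using half[OF sigma_add_sigma'[OF two h] refl] trans[of h]
      by (metis span_add span_diff span_scale)
  qed
  have "sigma M h \<in> span ?U" for h
  proof (cases "h = 0 \<or> fst h = 1")
    case False
    then have "fst h = 0" "h \<noteq> 0" using two_cases[of "fst h"] by auto
    then show ?thesis using trans by (simp add: sigma_double[OF two])
  qed (use both in blast)
  then show "scheme M \<subseteq> span ?U" using both by (auto simp: scheme_eq)
qed

text \<open>
  The scaling of the basis elements makes the first ones idempotent, as \<open>\<theta> \<theta>\<^sup>T \<otimes> J\<^sub>2\<close> squares to \<open>2|H|\<close> times
  itself, and makes \<open>I \<otimes> D\<^sub>2\<close> into the unit of the second part.
\<close>

lemma adjacency_alg_scheme:
  fixes M :: "(int, 'g::{finite, ab_group_add}) sqmat"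
  assumes card_n: "CARD('n::finite) = 2 * CARD('g)" and card_m: "CARD('m::finite) = CARD('g)"
    and card_2: "2 \<le> CARD('g)"
    and two: "\<forall>x::'g. x + x = 0" and adm: "admissible M"
  shows "adjacency_alg (scheme M) \<cong>\<^sub>J
      (copies real_alg :: (real ^ 'n) alg) \<oplus>\<^sub>J
      spin_alg (\<lambda>x y :: real ^ 'm. \<Sum>i\<in>UNIV. x $ i * y $ i)"
proof -
  let ?X = "characters :: (2 \<times> 'g \<Rightarrow> real) set" and ?c = "real CARD(2 \<times> 'g)"
  have "CARD('n) = card ?X"
    using card_characters[OF pair_add_self[OF two]] card_n by simp
  then obtain \<beta> :: "'n \<Rightarrow> 2 \<times> 'g \<Rightarrow> real" where \<beta>: "bij_betw \<beta> UNIV ?X"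
    using finite_same_card_bij[OF finite finite_characters] by blast
  obtain \<tau> :: "'m \<Rightarrow> 'g" where \<tau>: "bij \<tau>"
    using finite_same_card_bij[OF finite finite card_m] by blast
  have \<beta>_in: "\<beta> i \<in> ?X" and \<beta>_eq: "\<beta> i = \<beta> j \<longleftrightarrow> i = j" for i j
    using \<beta> by (auto simp: bij_betw_def inj_on_def)
  have \<tau>_eq: "\<tau> i = \<tau> j \<longleftrightarrow> i = j" for i j
    using \<tau> by (auto simp: bij_def inj_def)
  define e where "e = (\<lambda>i. (1 / (2 * ?c)) *\<^sub>R (char_mat (\<beta> i) \<otimes>\<^sub>K J2))"
  define u where "u = (1/2) *\<^sub>R (mat 1 \<otimes>\<^sub>K D2 :: (complex, (2 \<times> 'g) \<times> 2) sqmat)"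
  define f where "f = (\<lambda>j. (1/2) *\<^sub>R (clifford M (\<tau> j) \<otimes>\<^sub>K D2))"
  note scale = bilinear_lmul[OF bilinear_jordan_prod] bilinear_rmul[OF bilinear_jordan_prod]
  note JJ = jordan_prod_kronecker[OF J2_J2 J2_J2] and DD = jordan_prod_kronecker[OF D2_D2 D2_D2]
    and JD = jordan_prod_kronecker_zero[OF J2_D2 D2_J2]
  have c: "?c \<noteq> 0" by simp
  have jc: "jordan_prod (char_mat (\<beta> i)) (char_mat (\<beta> j)) = (if i = j then ?c *\<^sub>R char_mat (\<beta> i) else 0)" for i j
    using char_mat_mult[OF \<beta>_in[of i] \<beta>_in[of j]] char_mat_mult[OF \<beta>_in[of j] \<beta>_in[of i]]
    by (auto simp: jordan_prod_def \<beta>_eq simp flip: scaleR_2)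
  have ones: "jordan_prod (mat 1) A = A" for A :: "(complex, 2 \<times> 'g) sqmat"
    by (simp add: jordan_prod_def flip: scaleR_2)
  have ee: "jordan_prod (e i) (e j) = (if i = j then e i else 0)" for i j
    using c by (simp add: e_def scale JJ jc kronecker_scaleR_left kronecker_zero del: card_prod)
  have eu: "jordan_prod (e i) u = 0" and ef: "jordan_prod (e i) (f j) = 0" for i j
    by (simp_all add: e_def u_def f_def scale JD)
  have uu: "jordan_prod u u = u" and uf: "jordan_prod u (f j) = f j" for j
    by (simp_all add: u_def f_def scale DD ones)
  have ff: "jordan_prod (f i) (f j) = (if i = j then u else 0)" for i j
    by (simp add: f_def u_def scale DD clifford_relations[OF two adm] \<tau>_eq kronecker_zero)
  have e0: "e i \<noteq> 0" for i
  proof -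
    have "(char_mat (\<beta> i) \<otimes>\<^sub>K J2) $ (0, 0) $ (0, 0) = 1"
      by (simp add: char_mat_def character_zero[OF \<beta>_in] J2_entry)
    then have "char_mat (\<beta> i) \<otimes>\<^sub>K J2 \<noteq> 0" by (metis zero_index zero_neq_one)
    then show ?thesis by (simp add: e_def)
  qed
  have u0: "u \<noteq> 0"
  proof -
    have "(mat 1 \<otimes>\<^sub>K D2 :: (complex, (2 \<times> 'g) \<times> 2) sqmat) $ (0, 0) $ (0, 0) = 1"
      by (simp add: mat_def D2_def I2_entry K2_entry)
    then have "(mat 1 \<otimes>\<^sub>K D2 :: (complex, (2 \<times> 'g) \<times> 2) sqmat) \<noteq> 0" by (metis zero_index zero_neq_one)
    then show ?thesis by (simp add: u_def)
  qed
  have "span (scheme M) = span (range e \<union> {u} \<union> range f)"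
  proof -
    have 1: "(\<lambda>\<theta>. char_mat \<theta> \<otimes>\<^sub>K J2) ` ?X = range (\<lambda>i. char_mat (\<beta> i) \<otimes>\<^sub>K J2)"
      unfolding bij_betw_imp_surj_on[OF \<beta>, symmetric] image_image ..
    have 2: "range (\<lambda>t. clifford M t \<otimes>\<^sub>K D2) = range (\<lambda>j. clifford M (\<tau> j) \<otimes>\<^sub>K D2)"
      using \<tau> by (auto simp: bij_def image_iff) (metis surjD)
    have scaled: "v \<in> span (range e \<union> {u} \<union> range f)" if "k *\<^sub>R v \<in> range e \<union> {u} \<union> range f" "k \<noteq> 0" for k v
      using span_base[OF that(1)] that(2) by (simp add: in_span_scaleR_iff)
    show ?thesis
      unfolding span_scheme[OF two adm] 1 2
    proof (subst span_eq, rule conjI)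
      have "char_mat (\<beta> i) \<otimes>\<^sub>K J2 \<in> span (range e \<union> {u} \<union> range f)" for i
        by (rule scaled[of "1 / (2 * ?c)"]) (auto simp: e_def)
      moreover have "mat 1 \<otimes>\<^sub>K D2 \<in> span (range e \<union> {u} \<union> range f)"
        by (rule scaled[of "1/2"]) (auto simp: u_def)
      moreover have "clifford M (\<tau> j) \<otimes>\<^sub>K D2 \<in> span (range e \<union> {u} \<union> range f)" for j
        by (rule scaled[of "1/2"]) (auto simp: f_def)
      ultimately show "range (\<lambda>i. char_mat (\<beta> i) \<otimes>\<^sub>K J2) \<union> {mat 1 \<otimes>\<^sub>K D2} \<union>
          range (\<lambda>j. clifford M (\<tau> j) \<otimes>\<^sub>K D2) \<subseteq> span (range e \<union> {u} \<union> range f)"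
        by blast
    qed (auto simp: e_def u_def f_def intro!: span_scale intro: span_base)
  qed
  then show ?thesis
    using span_iso_copies_spin[OF bilinear_jordan_prod jordan_prod_commute ee eu ef uu uf ff e0 u0] card_2 card_m
    by (simp add: adjacency_alg_def)
qed

lemma jordan_scheme_scheme:
  fixes M :: "(int, 'g::{finite, ab_group_add}) sqmat"
  assumes two: "\<forall>x::'g. x + x = 0"
    and alg: "jordan_algebra (adjacency_alg (scheme M))"
  shows "jordan_scheme (scheme M)"
proof (rule jordan_schemeI)
  have plus: "0 = p + q \<longleftrightarrow> p = q" for p q :: "2 \<times> 'g"
    using pair_translate_iff[OF two, of q p 0] by auto
  have "sigma M 0 = mat 1"
  proof -
    have "sigma M 0 $ P $ Q = mat 1 $ P $ Q" for P Q
    proof (cases "fst P = fst Q")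
      case True
      then have "agree M P Q \<longleftrightarrow> P = Q" by (auto simp: agree_def edge_sign_def prod_eq_iff)
      then show ?thesis using True by (simp add: sigma_entry[OF two] plus mat_def)
    next
      case False
      then have "P \<noteq> Q" by blast
      then show ?thesis using False by (simp add: sigma_entry[OF two] plus mat_def)
    qed
    then show ?thesis by (simp add: vec_eq_iff)
  qed
  moreover have "sigma M 0 \<in> scheme M" unfolding scheme_eq by blast
  ultimately show "mat 1 \<in> scheme M" by simp
next
  fix A P Q assume A: "A \<in> scheme M"
  then have "A $ P $ Q \<in> {0, 1} \<and> A $ P $ Q = A $ Q $ P" for P Q
  proof (cases rule: scheme_cases)
    case (sigma h)
    then show ?thesis
      by (simp add: sigma_entry[OF two] add.commute[of "fst P"] agree_commute[of M P])
  next
    case (sigma' h)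
    then show ?thesis
      by (simp add: sigma'_entry[OF two sigma'(1)] add.commute[of "fst P"] agree_commute[of M P])
  qed
  then show "A $ P $ Q \<in> {0, 1}" and "transpose A = A"
    by (simp_all add: transpose_def vec_eq_iff)
next
  fix A B assume "A \<in> scheme M" "B \<in> scheme M"
  then show "jordan_prod A B \<in> span (scheme M)"
    using jordan_algebraD(2)[OF alg] by (simp add: adjacency_alg_def span_base)
next
  show "finite (scheme M)" by (simp add: scheme_eq)
qed (rule scheme_is_partition[OF two] zero_notin_scheme[OF two])+

theorem theorem5p3:
  fixes M :: "(int, 'g::{finite, ab_group_add}) sqmat"
  assumes order_8: "CARD('g) = 8"
    and elementary_abelian: "\<forall>x::'g. x + x = 0"
    and admissible: "admissible M"
  shows "jordan_scheme (scheme M) \<and>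
    adjacency_alg (scheme M) \<cong>\<^sub>J
      (copies real_alg :: (real ^ 16) alg) \<oplus>\<^sub>J
      spin_alg (\<lambda>x y :: real ^ 8. \<Sum>i\<in>UNIV. x $ i * y $ i)"
proof -
  have "adjacency_alg (scheme M) \<cong>\<^sub>J
      (copies real_alg :: (real ^ 16) alg) \<oplus>\<^sub>J
      spin_alg (\<lambda>x y :: real ^ 8. \<Sum>i\<in>UNIV. x $ i * y $ i)"
    by (rule adjacency_alg_scheme) (simp_all add: order_8 elementary_abelian admissible)
  then show ?thesis
    using jordan_scheme_scheme[OF elementary_abelian] unfolding jordan_isomorphic_def by blast
qed

end
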